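(* Consider the aggregate-and-iterative-disaggregate (AID) algorithm for least absolute deviation regression with data $x\in\mathbb{R}^{n\times m}$, $y\in\mathbb{R}^n$, with optimal aggregated values $F^t$, original objective values $E^t$, and last iteration $T$. Then $F^{t-1}\le F^t$ for $t=1,\dots,T$. Further, $F^T=E^T=E^*$, where $E^*=\min_{\beta\in\mathbb{R}^m}\sum_{i\in I}|y_i-\sum_{j\in J}x_{ij}\beta_j|$.
   Context: $I=\{1,\dots,n\}$, $J=\{1,\dots,m\}$. The algorithm starts from an arbitrary partition $C^0$ of $I$ into nonempty clusters. In iteration $t$, given the partition $C^t=\{C_k^t\}_{k\in K^t}$, set $x_{kj}^t=\frac{1}{|C_k^t|}\sum_{i\in C_k^t}x_{ij}$ and $y_k^t=\frac{1}{|C_k^t|}\sum_{i\in C_k^t}y_i$; let $$F^t=\min_{\beta\in\mathbb{R}^m}\sum_{k\in K^t}|C_k^t|\,\Big|y_k^t-\sum_{j\in J}x_{kj}^t\beta_j\Big|,$$ let $\bar\beta^t$ be an optimal solution of this problem, and let $E^t=\sum_{i\in I}|y_i-\sum_{j\in J}x_{ij}\bar\beta_j^t|$. Optimality condition: for every $k\in K^t$ the residuals $y_i-\sum_jx_{ij}\bar\beta_j^t$, $i\in C_k^t$, all have the same sign (all $>0$, or all $\le0$). If it holds, the algorithm stops and $T:=t$. Otherwise $C^{t+1}$ is obtained from $C^t$ by keeping every cluster whose residuals have the same sign, and replacing every other cluster $C_k^t$ by the two clusters $\{i\in C_k^t: y_i-\sum_jx_{ij}\bar\beta_j^t>0\}$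 and $\{i\in C_k^t: y_i-\sum_jx_{ij}\bar\beta_j^t\le0\}$. *)

theory Defs
  imports "HOL-Analysis.Analysis" "HOL-Library.Disjoint_Sets"
begin

definition residual :: "real^'m^'n \<Rightarrow> real^'n \<Rightarrow> real^'m \<Rightarrow> 'n \<Rightarrow> real" where
  "residual x y \<beta> i = y $ i - (\<Sum>j\<in>UNIV. x $ i $ j * \<beta> $ j)"

definition lad_obj :: "real^'m^'n \<Rightarrow> real^'n \<Rightarrow> real^'m \<Rightarrow> real" where
  "lad_obj x y \<beta> = (\<Sum>i\<in>UNIV. \<bar>residual x y \<beta> i\<bar>)"

definition agg_x :: "real^'m^'n \<Rightarrow> 'n set \<Rightarrow> real^'m" where
  "agg_x x c = (\<chi> j. (\<Sum>i\<in>c. x $ i $ j) / real (card c))"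

definition agg_y :: "real^'n \<Rightarrow> 'n set \<Rightarrow> real" where
  "agg_y y c = (\<Sum>i\<in>c. y $ i) / real (card c)"

text \<open>The family of clusters $(C_k)_{k \in K}$ is represented by the set of its members:
  the clusters of a partition are nonempty and disjoint, hence pairwise distinct.\<close>

definition agg_obj :: "real^'m^'n \<Rightarrow> real^'n \<Rightarrow> 'n set set \<Rightarrow> real^'m \<Rightarrow> real" where
  "agg_obj x y P \<beta> =
     (\<Sum>c\<in>P. real (card c) * \<bar>agg_y y c - (\<Sum>j\<in>UNIV. agg_x x c $ j * \<beta> $ j)\<bar>)"

text \<open>On the reals, \<^const>\<open>Least\<close> is the minimum of a set, and is unspecified if the minimum is not
  attained.\<close>

definition min_value :: "('a \<Rightarrow> real) \<Rightarrow> real" where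
  "min_value f = (LEAST v. v \<in> range f)"

definition same_sign :: "real^'m^'n \<Rightarrow> real^'n \<Rightarrow> real^'m \<Rightarrow> 'n set \<Rightarrow> bool" where
  "same_sign x y \<beta> c \<longleftrightarrow>
     (\<forall>i\<in>c. residual x y \<beta> i > 0) \<or> (\<forall>i\<in>c. residual x y \<beta> i \<le> 0)"

definition optimality_cond :: "real^'m^'n \<Rightarrow> real^'n \<Rightarrow> 'n set set \<Rightarrow> real^'m \<Rightarrow> bool" where
  "optimality_cond x y P \<beta> \<longleftrightarrow> (\<forall>c\<in>P. same_sign x y \<beta> c)"

definition disaggregate ::
    "real^'m^'n \<Rightarrow> real^'n \<Rightarrow> 'n set set \<Rightarrow> real^'m \<Rightarrow> 'n set set" where
  "disaggregate x y P \<beta> =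
     (\<Union>c\<in>P. if same_sign x y \<beta> c then {c}
             else {{i \<in> c. residual x y \<beta> i > 0}, {i \<in> c. residual x y \<beta> i \<le> 0}})"

text \<open>\<open>C t\<close> and \<open>\<beta> t\<close> are the partition and the chosen optimal solution of iteration \<open>t\<close>.
  Only iterations that are actually performed are constrained: the values of \<open>C\<close> and \<open>\<beta>\<close> after
  the optimality condition has first been met are arbitrary. Termination is not assumed.\<close>

definition aid_run ::
    "real^'m^'n \<Rightarrow> real^'n \<Rightarrow> (nat \<Rightarrow> 'n set set) \<Rightarrow> (nat \<Rightarrow> real^'m) \<Rightarrow> bool" where
  "aid_run x y C \<beta> \<longleftrightarrow>
     partition_on UNIV (C 0) \<and>
     (\<forall>t. (\<forall>s<t. \<not> optimality_cond x y (C s) (\<beta> s)) \<longrightarrow>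
        is_arg_min (agg_obj x y (C t)) (\<lambda>_. True) (\<beta> t)) \<and>
     (\<forall>t. (\<forall>s\<le>t. \<not> optimality_cond x y (C s) (\<beta> s)) \<longrightarrow>
        C (Suc t) = disaggregate x y (C t) (\<beta> t))"

definition last_iteration ::
    "real^'m^'n \<Rightarrow> real^'n \<Rightarrow> (nat \<Rightarrow> 'n set set) \<Rightarrow> (nat \<Rightarrow> real^'m) \<Rightarrow> nat" where
  "last_iteration x y C \<beta> = (LEAST t. optimality_cond x y (C t) (\<beta> t))"

text \<open>Every run stops, so \<^const>\<open>last_iteration\<close> is well defined: the relation of lying in a common
  cluster shrinks strictly with each disaggregation.\<close>

lemma aid_run_terminates:
  fixes x :: "real^'m^'n"
  assumes "aid_run x y C \<beta>"
  shows "\<exists>t. optimality_cond x y (C t) (\<beta> t)"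
proof (rule ccontr)
  assume "\<not> ?thesis"
  hence no: "\<not> optimality_cond x y (C t) (\<beta> t)" for t by blast
  with assms have step: "C (Suc t) = disaggregate x y (C t) (\<beta> t)" for t
    by (simp add: aid_run_def)
  define R where "R t = {(i, j). \<exists>c\<in>C t. i \<in> c \<and> j \<in> c}" for t
  have "R (Suc t) \<subset> R t" for t
  proof
    show "R (Suc t) \<subseteq> R t"
      unfolding R_def step disaggregate_def by (fastforce split: if_splits)
    obtain c i j where c: "c \<in> C t" "i \<in> c" "j \<in> c"
      "residual x y (\<beta> t) i \<le> 0" "residual x y (\<beta> t) j > 0"
      using no[of t] unfolding optimality_cond_def same_sign_def by (meson not_le)
    have "same_sign x y (\<beta> t) d" if "d \<in> C (Suc t)" for d
      using that unfolding step disaggregate_def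
      by (auto simp: same_sign_def split: if_splits)
    hence "(i, j) \<notin> R (Suc t)"
      using c(4,5) unfolding R_def same_sign_def by fastforce
    moreover have "(i, j) \<in> R t" using c unfolding R_def by blast
    ultimately show "R (Suc t) \<noteq> R t" by blast
  qed
  hence dec: "card (R (Suc t)) < card (R t)" for t
    by (simp add: psubset_card_mono)
  have "card (R t) + t \<le> card (R 0)" for t
  proof (induction t)
    case (Suc t) thus ?case using dec[of t] by linarith
  qed simp
  from this[of "Suc (card (R 0))"] show False by simp
qed

end

(* By the triangle inequality, refining the partition can only increase the aggregated objective at
   a fixed \<beta>. Disaggregation refines, so the optimal values F increase, and each of them is a lower
   bound for the original problem, whose clusters are the singletons. When all residuals within
   each cluster have the same sign, no cancellation occurs and the lower bound F T is attained at
   the solution \<beta> T. *)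
theory Submission
  imports Defs
begin

lemma min_value_arg_min:
  assumes "is_arg_min f (\<lambda>_. True) a"
  shows "min_value f = f a"
  unfolding min_value_def
  by (rule Least_equality) (use assms in \<open>auto simp: is_arg_min_linorder\<close>)

lemma partition_on_UN:
  assumes P: "partition_on A P" and S: "\<And>c. c \<in> P \<Longrightarrow> partition_on c (S c)"
  shows "partition_on A (\<Union>c\<in>P. S c)"
proof -
  have Union: "\<Union>(S c) = c" if "c \<in> P" for c
    using partition_onD1[OF S[OF that]] ..
  have "disjoint_family_on (\<lambda>c. \<Union>(S c)) P"
    unfolding disjoint_family_on_def
    using Union disjointD[OF partition_onD2[OF P]] by simp
  hence "disjoint (\<Union>c\<in>P. S c)"
    using S by (intro disjoint_UN partition_onD2)
  moreover have "(\<Union>c\<in>P. \<Union>(S c)) = A"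
    by (simp add: Union flip: partition_onD1[OF P])
  hence "\<Union>(\<Union>c\<in>P. S c) = A" by blast
  moreover have "{} \<notin> (\<Union>c\<in>P. S c)"
    using partition_onD3[OF S] by blast
  ultimately show ?thesis by (simp add: partition_on_def)
qed

text \<open>Within one block \<open>c\<close>, \<open>sum f c\<close> is the sum of
  \<open>sum f d\<close> over the pieces \<open>d\<close> of \<open>c\<close>, so the triangle
  inequality applies block by block. It is used with \<open>f\<close> the residual, where it
  compares a partition with its refinement.\<close>

lemma sum_abs_sum_partition_UN:
  fixes f :: "'a \<Rightarrow> real"
  assumes fin: "finite A" and P: "partition_on A P"
    and S: "\<And>c. c \<in> P \<Longrightarrow> partition_on c (S c)"
  shows "(\<Sum>c\<in>P. \<bar>sum f c\<bar>) \<le> (\<Sum>d\<in>(\<Union>c\<in>P. S c). \<bar>sum f d\<bar>)"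
proof -
  have fin_c: "finite c" if "c \<in> P" for c
    using finite_subset[OF Sup_upper[OF that]] fin by (simp add: partition_onD1[OF P])
  \<comment> \<open>The union of the \<open>S c\<close> is a set, so a piece shared by two blocks
    would be counted only once. Such a piece would lie in two disjoint blocks and hence be empty,
    but pieces are nonempty.\<close>
  have disj: "S c \<inter> S c' = {}" if c: "c \<in> P" "c' \<in> P" "c \<noteq> c'" for c c'
  proof -
    have "d = {}" if "d \<in> S c" "d \<in> S c'" for d
      using disjointD[OF partition_onD2[OF P] c] partition_onD1[OF S[OF c(1)]]
        partition_onD1[OF S[OF c(2)]] that by blast
    thus ?thesis using partition_onD3[OF S[OF c(1)]] by blast
  qed
  have "(\<Sum>c\<in>P. \<bar>sum f c\<bar>) \<le> (\<Sum>c\<in>P. \<Sum>d\<in>S c. \<bar>sum f d\<bar>)"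
  proof (rule sum_mono)
    fix c assume "c \<in> P"
    hence "sum f c = (\<Sum>d\<in>S c. sum f d)" using sum.partition[OF fin_c S] by simp
    thus "\<bar>sum f c\<bar> \<le> (\<Sum>d\<in>S c. \<bar>sum f d\<bar>)" by simp
  qed
  also have "\<dots> = (\<Sum>d\<in>(\<Union>c\<in>P. S c). \<bar>sum f d\<bar>)"
    using disj finite_elements[OF fin P] finite_elements[OF fin_c S]
    by (intro sum.UNION_disjoint[symmetric]) auto
  finally show ?thesis .
qed

text \<open>The weight \<open>card c\<close> cancels the denominators of the averages, which are
  nonzero because clusters are nonempty. What remains is a sum of absolute values of sums, ready for
  the triangle inequality.\<close>

lemma agg_obj_residual:
  assumes "partition_on UNIV P"
  shows "agg_obj x y P \<beta> = (\<Sum>c\<in>P. \<bar>\<Sum>i\<in>c. residual x y \<beta> i\<bar>)"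
  unfolding agg_obj_def
proof (rule sum.cong[OF refl])
  fix c assume "c \<in> P"
  hence "c \<noteq> {}" using assms partition_onD3 by blast
  hence pos: "real (card c) > 0" by (simp add: card_gt_0_iff)
  have "(\<Sum>j\<in>UNIV. agg_x x c $ j * \<beta> $ j) = (\<Sum>j\<in>UNIV. \<Sum>i\<in>c. x $ i $ j * \<beta> $ j) / real (card c)"
    by (simp add: agg_x_def sum_divide_distrib sum_distrib_right)
  also have "(\<Sum>j\<in>UNIV. \<Sum>i\<in>c. x $ i $ j * \<beta> $ j) = (\<Sum>i\<in>c. \<Sum>j\<in>UNIV. x $ i $ j * \<beta> $ j)"
    by (rule sum.swap)
  finally have "agg_y y c - (\<Sum>j\<in>UNIV. agg_x x c $ j * \<beta> $ j)
      = (\<Sum>i\<in>c. residual x y \<beta> i) / real (card c)"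
    by (simp add: agg_y_def residual_def sum_subtractf diff_divide_distrib)
  thus "real (card c) * \<bar>agg_y y c - (\<Sum>j\<in>UNIV. agg_x x c $ j * \<beta> $ j)\<bar>
      = \<bar>\<Sum>i\<in>c. residual x y \<beta> i\<bar>"
    using pos by (simp add: abs_divide)
qed

lemma agg_obj_le_lad_obj:
  assumes P: "partition_on UNIV P"
  shows "agg_obj x y P \<beta> \<le> lad_obj x y \<beta>"
  unfolding agg_obj_residual[OF P] lad_obj_def sum.partition[OF finite P]
  by (rule sum_mono) (rule sum_abs)

lemma agg_obj_eq_lad_obj:
  assumes P: "partition_on UNIV P" and opt: "optimality_cond x y P \<beta>"
  shows "agg_obj x y P \<beta> = lad_obj x y \<beta>"
proof -
  have "\<bar>\<Sum>i\<in>c. residual x y \<beta> i\<bar> = (\<Sum>i\<in>c. \<bar>residual x y \<beta> i\<bar>)" if "c \<in> P" for c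
  proof -
    have "same_sign x y \<beta> c" using opt that by (simp add: optimality_cond_def)
    then consider "\<forall>i\<in>c. residual x y \<beta> i > 0" | "\<forall>i\<in>c. residual x y \<beta> i \<le> 0"
      unfolding same_sign_def by blast
    thus ?thesis
    proof cases
      case 1
      thus ?thesis by (simp add: less_imp_le sum_nonneg)
    next
      case 2
      thus ?thesis by (simp add: sum_nonpos abs_of_nonpos flip: sum_negf)
    qed
  qed
  thus ?thesis
    by (simp add: agg_obj_residual[OF P] lad_obj_def sum.partition[OF finite P])
qed

text \<open>When \<open>same_sign\<close> fails, both sign classes are inhabited, so the split
  creates no empty cluster.\<close>

lemma partition_on_split_same_sign:
  assumes "c \<noteq> {}"
  shows "partition_on c (if same_sign x y \<beta> c then {c}
    else {{i \<in> c. residual x y \<beta> i > 0}, {i \<in> c. residual x y \<beta> i \<le> 0}})"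
proof (cases "same_sign x y \<beta> c")
  case True
  with assms show ?thesis by (simp add: partition_on_space)
next
  case False
  thus ?thesis
    by (auto simp: partition_on_def pairwise_insert disjnt_iff same_sign_def not_le)
qed

text \<open>The point \<open>b\<close> of comparison is independent of the \<open>\<beta>\<close>
  that determines the split: the monotonicity of \<open>F\<close> compares the two objectives at the
  solution of the later problem.\<close>

lemma
  assumes P: "partition_on UNIV P"
  shows partition_on_disaggregate: "partition_on UNIV (disaggregate x y P \<beta>)"
    and agg_obj_le_disaggregate: "agg_obj x y P b \<le> agg_obj x y (disaggregate x y P \<beta>) b"
proof -
  have split: "partition_on c (if same_sign x y \<beta> c then {c}
      else {{i \<in> c. residual x y \<beta> i > 0}, {i \<in> c. residual x y \<beta> i \<le> 0}})" if "c \<in> P" for c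
    using partition_on_split_same_sign[of c] partition_onD3[OF P] that by blast
  show D: "partition_on UNIV (disaggregate x y P \<beta>)"
    unfolding disaggregate_def by (rule partition_on_UN[OF P split])
  show "agg_obj x y P b \<le> agg_obj x y (disaggregate x y P \<beta>) b"
    unfolding agg_obj_residual[OF P] agg_obj_residual[OF D]
    unfolding disaggregate_def by (rule sum_abs_sum_partition_UN[OF finite P split])
qed

theorem proposition2:
  fixes x :: "real^'m^'n" and y :: "real^'n"
    and C :: "nat \<Rightarrow> 'n set set" and \<beta> :: "nat \<Rightarrow> real^'m"
    and F E :: "nat \<Rightarrow> real" and T :: nat
  assumes run: "aid_run x y C \<beta>"
    and F: "\<And>t. F t = min_value (agg_obj x y (C t))"
    and E: "\<And>t. E t = lad_obj x y (\<beta> t)"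
    and T: "T = last_iteration x y C \<beta>"
  shows "(\<forall>t\<in>{1..T}. F (t - 1) \<le> F t) \<and> F T = E T \<and> E T = min_value (lad_obj x y)"
proof -
  have stop: "optimality_cond x y (C T) (\<beta> T)"
    using aid_run_terminates[OF run] unfolding T last_iteration_def by (rule LeastI_ex)
  have continue: "\<not> optimality_cond x y (C s) (\<beta> s)" if "s < T" for s
    using that not_less_Least unfolding T last_iteration_def by blast
  have step: "C (Suc t) = disaggregate x y (C t) (\<beta> t)" if "t < T" for t
    using run that continue by (simp add: aid_run_def)
  have part: "partition_on UNIV (C t)" if "t \<le> T" for t
    using that
  proof (induction t)
    case 0
    thus ?case using run by (simp add: aid_run_def)
  next
    case (Suc t)
    thus ?case by (simp add: step partition_on_disaggregate)
  qed
  \<comment> \<open>The bound includes \<open>T\<close>: \<open>\<beta> t\<close> is optimal as soon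
    as the condition failed at all \<open>s < t\<close>, whereas a disaggregation at
    \<open>t\<close> also needs failure at \<open>t\<close> itself.\<close>
  have arg_min: "is_arg_min (agg_obj x y (C t)) (\<lambda>_. True) (\<beta> t)" if "t \<le> T" for t
    using run that continue by (simp add: aid_run_def)
  have F_eq: "F t = agg_obj x y (C t) (\<beta> t)" if "t \<le> T" for t
    using min_value_arg_min[OF arg_min[OF that]] F by simp
  have F_le: "F t \<le> agg_obj x y (C t) b" if "t \<le> T" for t b
    using arg_min[OF that] F_eq[OF that] by (simp add: is_arg_min_linorder)
  have mono: "F (t - 1) \<le> F t" if t: "t \<in> {1..T}" for t
  proof -
    obtain s where s: "t = Suc s" "s < T" using t by (cases t) auto
    \<comment> \<open>The later solution \<open>\<beta> (Suc s)\<close> serves as a candidate in the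
      earlier problem, which has the same feasible set.\<close>
    have "F s \<le> agg_obj x y (C s) (\<beta> (Suc s))" using F_le s by simp
    also have "\<dots> \<le> agg_obj x y (C (Suc s)) (\<beta> (Suc s))"
      using s by (simp add: step agg_obj_le_disaggregate part)
    also have "\<dots> = F (Suc s)" using F_eq s by simp
    finally show ?thesis using s by simp
  qed
  have FT: "F T = E T"
    using agg_obj_eq_lad_obj[OF part stop] F_eq E by simp
  \<comment> \<open>For every \<open>b\<close>,
    \<open>E T = F T \<le> agg_obj x y (C T) b \<le> lad_obj x y b\<close>. Since \<open>E T\<close>
    is the value at \<open>\<beta> T\<close>, the minimum of \<open>lad_obj\<close> is attained
    there, as \<open>min_value\<close> requires.\<close>
  have "E T \<le> lad_obj x y b" for b
    using F_le[of T b] agg_obj_le_lad_obj[OF part, of T x y b] FT by simp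
  hence "is_arg_min (lad_obj x y) (\<lambda>_. True) (\<beta> T)"
    by (simp add: is_arg_min_linorder E)
  from min_value_arg_min[OF this] have "E T = min_value (lad_obj x y)" by (simp add: E)
  with mono FT show ?thesis by blast
qed

end
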